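(* Assume $\boldsymbol{x}\in\mathbb{R}^n$ with $\boldsymbol{x}\ne\boldsymbol{0}$ is $d$-dimensional data such that $F_{\mathcal{B}}^{-1}(\boldsymbol{x})\in\mathcal{B}_k^n$ for some precision $k$, and let $\hat{\boldsymbol{x}}$ represent the compressed and decompressed values from using the fixed accuracy mode of ZFP. To guarantee $b\in\mathbb{N}$ bits of accuracy, i.e., $\|\hat{\boldsymbol{x}}-\boldsymbol{x}\|_\infty\le2^{-b}$, $\beta$ must satisfy $$\beta\ \ge\ \log_2\left(\frac{\frac{16}{3}(1+c)}{\dfrac{\left(\frac{4}{15}\right)^d2^{-b-e_{max}}-\epsilon_k}{1+\epsilon_k}-c}\right),$$ where $c=\epsilon_q\left(k_L(1+\epsilon_q)+1\right)$, $k_L=\frac74(2^d-1)$, $\epsilon_m=2^{1-m}$ and $e_{max}:=e_{max}(\boldsymbol{x})$.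
   Context: **Bit spaces.** $\epsilon_m:=2^{1-m}$ for $m\in\mathbb{Z}$. $\mathcal{C}$ is the set of sequences $c=(c_i)_{i\in\mathbb{Z}}$ with $c_i\in\{0,1\}$, and $\mathcal{I}(c)=\{i:c_i=1\}$. For each $x\in\mathbb{R}$ fix one signed binary representation $x=(-1)^p\sum_i a_i2^i$ ($p\in\{0,1\}$, $a\in\mathcal{C}$) and one negabinary representation $x=\sum_i d_i(-2)^i$ ($d\in\mathcal{C}$), using representations with finitely many nonzero digits whenever they exist (and $p=0$ for $x=0$). $\mathcal{B}$ is the set of all chosen pairs $(p,a)$ and $\mathcal{N}$ the set of all chosen $d$; $f_{\mathcal{B}}:\mathcal{B}\to\mathbb{R}$, $f_{\mathcal{N}}:\mathcal{N}\to\mathbb{R}$ are the resulting bijections, and $F_{\mathcal{B}},F_{\mathcal{N}}$ their componentwise versions on $\mathcal{B}^n,\mathcal{N}^n$. For $b=(p,a)\in\mathcal{B}$ write $\mathcal{I}(b)=\mathcal{I}(a)$. $\mathcal{B}_k$ is the set of $b\in\mathcal{B}$ with $\mathcal{I}(b)\subseteq\{i,i+1,\dots,i+k-1\}$ for some $i\in\mathbb{Z}$. For $\boldsymbol{x}\in\mathbb{R}^n$, $e_{max}(\boldsymbol{x})=\max_{i}\max\mathcal{I}(f_{\mathcal{B}}^{-1}(\boldsymbol{x}_i))$. For $\mathcal{S}\subseteq\mathbb{Z}$ the truncation $T_{\mathcal{S}}$ sets, in each component, all bits with index not in $\mathcal{S}$ to $0$; the shift $S_\ell$ replaces each component's bit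 sequence $c$ by $(c_{i+\ell})_i$; on $\mathcal{B}$ both keep the sign. **Linear transform.** $$L=\frac1{16}\begin{bmatrix}4&4&4&4\\5&1&-1&-5\\-4&4&4&-4\\-2&6&-6&2\end{bmatrix},\qquad L_d=L\otimes\cdots\otimes L\ (d\text{ factors}).$$ The lossy version $\tilde{L}:\mathbb{Z}^4\to\mathbb{Z}^4$ is the result of the following sequential assignments on $(a_1,a_2,a_3,a_4)$, where $r(a)=\lfloor a/2\rfloor$: $a_1\leftarrow a_1+a_4$; $a_1\leftarrow r(a_1)$; $a_4\leftarrow a_4-a_1$; $a_3\leftarrow a_3+a_2$; $a_3\leftarrow r(a_3)$; $a_2\leftarrow a_2-a_3$; $a_1\leftarrow a_1+a_3$; $a_1\leftarrow r(a_1)$; $a_3\leftarrow a_3-a_1$; $a_4\leftarrow a_4+a_2$; $a_4\leftarrow r(a_4)$; $a_2\leftarrow a_2-a_4$; $a_4\leftarrow a_4+r(a_2)$; $a_2\leftarrow a_2-r(a_4)$. The map $\tilde{L}_d:\mathbb{Z}^{4^d}\to\mathbb{Z}^{4^d}$ views its input as a $4\times\cdots\times4$ ($d$-dimensional) array and applies $\tilde{L}$ along each of the $d$ coordinate directions. **ZFP.** The $d$-dimensional data (padded if necessary) are partitioned into blocks of $4^d$ values, and each block is processed independently. For a block $\boldsymbol{y}\in\mathbb{R}^{4^d}$ put $\ell=e_{max}(\boldsymbol{y})-q+1$, where $q\in\mathbb{N}$ is the precision of the block-floating-point representation. Compression consists of: $\tilde{C}_2(\boldsymbol{y})=T_{\mathcal{S}}S_\ell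 F_{\mathcal{B}}^{-1}(\boldsymbol{y})$ with $\mathcal{S}=\{i\ge0\}$ (conversion to integers); then $\tilde{C}_3=F_{\mathcal{B}}^{-1}\tilde{L}_dF_{\mathcal{B}}$; then a fixed permutation $C_4$ of the components; then the conversion $C_5=F_{\mathcal{N}}^{-1}F_{\mathcal{B}}$ to negabinary; and finally the removal of least significant bit planes of the resulting transform coefficients: keeping the $\beta$ most significant bit planes means applying $T_{\mathcal{P}}$ with $\mathcal{P}=\{i\in\mathbb{Z}:i>q+1-\beta\}$. Decompression applies $F_{\mathcal{B}}^{-1}F_{\mathcal{N}}$, then $C_4^{-1}$, then $F_{\mathcal{B}}^{-1}L_d^{-1}F_{\mathcal{B}}$, then $\boldsymbol{a}\mapsto F_{\mathcal{B}}S_{-\ell}\,fl_k(\boldsymbol{a})$, where $fl_k(\boldsymbol{a})_i$ is $\boldsymbol{a}_i$ truncated to the bits with index $j>\max\mathcal{I}(\boldsymbol{a}_i)-k$. **Fixed accuracy mode.** In this mode the transform coefficients in each $4^d$ block are encoded up to a minimum bit plane number; the index of the minimum bit plane depends on the largest absolute magnitude and on the constant $$K_\beta=\left(\tfrac{15}{4}\right)^d\left((1+\epsilon_k)\left(\tfrac{8}{3}\epsilon_\beta+\epsilon_q\left(1+\tfrac{8}{3}\epsilon_\beta\right)\left(k_L(1+\epsilon_q)+1\right)\right)+\epsilon_k\right).$$ Here $\beta$ is the number of most significant bit planes kept. *)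

theory Defs
  imports "HOL-Analysis.Analysis"
begin

definition eps :: "int \<Rightarrow> real" where
  "eps m = 2 powi (1 - m)"

section \<open>Bit spaces\<close>

type_synonym bits = "int \<Rightarrow> bool"
type_synonym sbits = "bool \<times> bits"

definition supp :: "bits \<Rightarrow> int set" where
  "supp c = {i. c i}"

text \<open>The evaluation maps are total; outside \<open>\<B>\<close> and \<open>\<N>\<close> (for instance on a truncated number with
  negative sign and no nonzero bit) they are still given by the defining series.\<close>

definition f_B :: "sbits \<Rightarrow> real" where
  "f_B b = (-1) ^ of_bool (fst b) * (\<Sum>\<^sub>\<infinity>i. of_bool (snd b i) * 2 powi i)"

definition f_N :: "bits \<Rightarrow> real" where
  "f_N c = (\<Sum>\<^sub>\<infinity>i. of_bool (c i) * (-2) powi i)"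

definition bin_repr :: "real \<Rightarrow> sbits \<Rightarrow> bool" where
  "bin_repr x b \<longleftrightarrow>
     (\<lambda>i. of_bool (snd b i) * 2 powi i :: real) summable_on UNIV \<and> f_B b = x"

definition negabin_repr :: "real \<Rightarrow> bits \<Rightarrow> bool" where
  "negabin_repr x c \<longleftrightarrow>
     (\<lambda>i. of_bool (c i) * (-2) powi i :: real) summable_on UNIV \<and> f_N c = x"

text \<open>The chosen representations, i.e. the inverses of the bijections
  \<open>f\<^sub>\<B> : \<B> \<rightarrow> \<real>\<close> and \<open>f\<^sub>\<N> : \<N> \<rightarrow> \<real>\<close>.\<close>

definition f_B_inv :: "real \<Rightarrow> sbits" where
  "f_B_inv x = (SOME b. bin_repr x b \<and> (x = 0 \<longrightarrow> \<not> fst b) \<and>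
     ((\<exists>b'. bin_repr x b' \<and> finite (supp (snd b'))) \<longrightarrow> finite (supp (snd b))))"

definition f_N_inv :: "real \<Rightarrow> bits" where
  "f_N_inv x = (SOME c. negabin_repr x c \<and>
     ((\<exists>c'. negabin_repr x c' \<and> finite (supp c')) \<longrightarrow> finite (supp c)))"

definition B_set :: "sbits set" where
  "B_set = range f_B_inv"

definition B_prec :: "nat \<Rightarrow> sbits set" where
  "B_prec k = {b \<in> B_set. \<exists>i. supp (snd b) \<subseteq> {i..i + int k - 1}}"

definition vmap :: "('a \<Rightarrow> 'b) \<Rightarrow> 'a ^ 'm \<Rightarrow> 'b ^ 'm" where
  "vmap f v = (\<chi> i. f (v $ i))"

text \<open>Components equal to 0 have no nonzero bit and do not contribute to the maximum. For
  \<open>x = 0\<close> the value is unspecified; the processing of an all-zero block does not depend on it.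
  The supremum of a nonempty set of integers that is bounded above is its maximum.\<close>

definition e_max :: "real ^ 'm \<Rightarrow> int" where
  "e_max x = Sup (\<Union>i. supp (snd (f_B_inv (x $ i))))"

definition trunc :: "int set \<Rightarrow> bits \<Rightarrow> bits" where
  "trunc S c = (\<lambda>i. i \<in> S \<and> c i)"

definition shift :: "int \<Rightarrow> bits \<Rightarrow> bits" where
  "shift l c = (\<lambda>i. c (i + l))"

definition keep_leading :: "nat \<Rightarrow> bits \<Rightarrow> bits" where
  "keep_leading k c = trunc {j. j > Sup (supp c) - int k} c"

section \<open>The decorrelating linear transform\<close>

text \<open>The numeral type \<open>4\<close> indexes the four positions as 1, 2, 3, 4 (where 4 = 0 in the type).
  A block of \<open>4\<^sup>d\<close> values is a vector indexed by the multi-indices \<open>'d \<Rightarrow> 4\<close>, with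
  \<open>d = CARD('d)\<close>.\<close>

definition L_mat :: "real ^ 4 ^ 4" where
  "L_mat = (1 / 16) *\<^sub>R vector
     [vector [ 4, 4,  4,  4],
      vector [ 5, 1, -1, -5],
      vector [-4, 4,  4, -4],
      vector [-2, 6, -6,  2]]"

text \<open>The entries of the Kronecker product \<open>L \<otimes> \<dots> \<otimes> L\<close>.\<close>

definition L_kron :: "real ^ ('d::finite \<Rightarrow> 4) ^ ('d \<Rightarrow> 4)" where
  "L_kron = (\<chi> i j. \<Prod>t\<in>UNIV. L_mat $ i t $ j t)"

definition half :: "int \<Rightarrow> int" where
  "half a = \<lfloor>real_of_int a / 2\<rfloor>"

definition L_lossy :: "int ^ 4 \<Rightarrow> int ^ 4" where
  "L_lossy a =
    (let a1 = a $ 1; a2 = a $ 2; a3 = a $ 3; a4 = a $ 4;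
         a1 = a1 + a4; a1 = half a1; a4 = a4 - a1;
         a3 = a3 + a2; a3 = half a3; a2 = a2 - a3;
         a1 = a1 + a3; a1 = half a1; a3 = a3 - a1;
         a4 = a4 + a2; a4 = half a4; a2 = a2 - a4;
         a4 = a4 + half a2; a2 = a2 - half a4
     in vector [a1, a2, a3, a4])"

definition L_lossy_along ::
    "'d \<Rightarrow> int ^ ('d::finite \<Rightarrow> 4) \<Rightarrow> int ^ ('d \<Rightarrow> 4)" where
  "L_lossy_along t a = (\<chi> i. L_lossy (\<chi> m. a $ (i(t := m))) $ (i t))"

text \<open>\<open>ts\<close> lists the coordinate directions in the order in which they are processed.\<close>

definition L_lossy_d ::
    "'d list \<Rightarrow> int ^ ('d::finite \<Rightarrow> 4) \<Rightarrow> int ^ ('d \<Rightarrow> 4)" where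
  "L_lossy_d ts = fold L_lossy_along ts"

section \<open>Compression and decompression of one block\<close>

definition block_exponent :: "nat \<Rightarrow> real ^ 'm \<Rightarrow> int" where
  "block_exponent q y = e_max y - int q + 1"

definition to_integers :: "nat \<Rightarrow> real ^ 'm \<Rightarrow> sbits ^ 'm" where
  "to_integers q y =
     vmap (apsnd (trunc {i. i \<ge> 0} \<circ> shift (block_exponent q y))) (vmap f_B_inv y)"

text \<open>The floor only converts the integer-valued reals \<open>f_B b\<close> to type \<open>int\<close>.\<close>

definition forward_transform ::
    "'d list \<Rightarrow> sbits ^ ('d::finite \<Rightarrow> 4) \<Rightarrow> sbits ^ ('d \<Rightarrow> 4)" where
  "forward_transform ts v =
     vmap (f_B_inv \<circ> of_int) (L_lossy_d ts (vmap (floor \<circ> f_B) v))"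

definition permute_comps :: "('m \<Rightarrow> 'm) \<Rightarrow> 'a ^ 'm \<Rightarrow> 'a ^ 'm" where
  "permute_comps p v = (\<chi> i. v $ p i)"

text \<open>\<open>w\<close> is the number of most significant bit planes kept. It may be negative, in which case
  also planes above the leading one are dropped.\<close>

definition compress_block ::
    "nat \<Rightarrow> 'd list \<Rightarrow> (('d \<Rightarrow> 4) \<Rightarrow> ('d \<Rightarrow> 4)) \<Rightarrow> int \<Rightarrow>
     real ^ ('d::finite \<Rightarrow> 4) \<Rightarrow> bits ^ ('d \<Rightarrow> 4)" where
  "compress_block q ts p w y =
     vmap (trunc {i. i > int q + 1 - w})
       (vmap (f_N_inv \<circ> f_B) (permute_comps p (forward_transform ts (to_integers q y))))"

definition decompress_block ::
    "nat \<Rightarrow> (('d \<Rightarrow> 4) \<Rightarrow> ('d \<Rightarrow> 4)) \<Rightarrow> int \<Rightarrow>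
     bits ^ ('d::finite \<Rightarrow> 4) \<Rightarrow> real ^ ('d \<Rightarrow> 4)" where
  "decompress_block k p l z =
    (let v = permute_comps (inv p) (vmap (f_B_inv \<circ> f_N) z);
         a = vmap f_B_inv (matrix_inv L_kron *v vmap f_B v)
     in vmap (f_B \<circ> apsnd (shift (- l) \<circ> keep_leading k)) a)"

definition zfp_block ::
    "nat \<Rightarrow> nat \<Rightarrow> 'd list \<Rightarrow> (('d \<Rightarrow> 4) \<Rightarrow> ('d \<Rightarrow> 4)) \<Rightarrow> int \<Rightarrow>
     real ^ ('d::finite \<Rightarrow> 4) \<Rightarrow> real ^ ('d \<Rightarrow> 4)" where
  "zfp_block k q ts p w y =
     decompress_block k p (block_exponent q y) (compress_block q ts p w y)"

section \<open>Partition of the data into blocks\<close>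

text \<open>A vector of \<open>\<real>\<^sup>n\<close> becomes \<open>d\<close>-dimensional data through a bijection \<open>pos\<close> of its indices with
  the cells of a grid of extent \<open>N t\<close> in direction \<open>t\<close>.\<close>

definition grid_layout :: "('d \<Rightarrow> nat) \<Rightarrow> ('n \<Rightarrow> 'd \<Rightarrow> nat) \<Rightarrow> bool" where
  "grid_layout N pos \<longleftrightarrow> bij_betw pos UNIV {u. \<forall>t. u t < N t}"

definition block_of :: "('d \<Rightarrow> nat) \<Rightarrow> ('d \<Rightarrow> nat)" where
  "block_of u = (\<lambda>t. u t div 4)"

text \<open>The position 1, 2, 3 or 4 (= 0) of a cell within its block.\<close>

definition offset_of :: "('d \<Rightarrow> nat) \<Rightarrow> ('d \<Rightarrow> 4)" where
  "offset_of u = (\<lambda>t. of_nat (u t mod 4 + 1))"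

text \<open>Cells outside the grid are filled with zeros or with data values from the same block.\<close>

definition padded ::
    "('n::finite \<Rightarrow> 'd \<Rightarrow> nat) \<Rightarrow> real ^ 'n \<Rightarrow> (('d \<Rightarrow> nat) \<Rightarrow> real) \<Rightarrow> bool" where
  "padded pos x X \<longleftrightarrow>
     (\<forall>i. X (pos i) = x $ i) \<and>
     (\<forall>u. u \<notin> range pos \<longrightarrow>
        X u \<in> insert 0 {x $ i | i. block_of (pos i) = block_of u})"

definition block ::
    "(('d \<Rightarrow> nat) \<Rightarrow> real) \<Rightarrow> ('d \<Rightarrow> nat) \<Rightarrow> real ^ ('d::finite \<Rightarrow> 4)" where
  "block X j = (\<chi> m. X (THE u. block_of u = j \<and> offset_of u = m))"

section \<open>Fixed accuracy mode\<close>

text \<open>\<open>W j\<close> is the number of most significant bit planes kept in block \<open>j\<close>. The lowest kept plane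
  of a block \<open>y\<close> has index \<open>q + 2 - W j\<close> in the scaled block, which is the plane
  \<open>e_max y + 3 - W j\<close> of the data. A parameter \<open>\<beta>\<close> either gives the number of planes kept in every
  block, so that the minimum bit plane follows the magnitude of the block, or fixes the common
  minimum bit plane \<open>e_max x + 3 - \<beta>\<close> for all blocks, so that \<open>\<beta>\<close> planes are kept in the
  blocks of largest magnitude. Both ways of encoding are admitted.\<close>

definition fixed_accuracy ::
    "nat \<Rightarrow> real ^ 'n \<Rightarrow> (('d::finite \<Rightarrow> nat) \<Rightarrow> real) \<Rightarrow> (('d \<Rightarrow> nat) \<Rightarrow> int) \<Rightarrow> bool" where
  "fixed_accuracy \<beta> x X W \<longleftrightarrow>
     (\<forall>j. W j = int \<beta>) \<or>
     (\<forall>j. W j = int \<beta> - (e_max x - e_max (block X j)))"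

definition zfp ::
    "nat \<Rightarrow> nat \<Rightarrow> 'd list \<Rightarrow> (('d \<Rightarrow> 4) \<Rightarrow> ('d \<Rightarrow> 4)) \<Rightarrow> (('d \<Rightarrow> nat) \<Rightarrow> int) \<Rightarrow>
     ('n \<Rightarrow> 'd::finite \<Rightarrow> nat) \<Rightarrow> (('d \<Rightarrow> nat) \<Rightarrow> real) \<Rightarrow> real ^ 'n" where
  "zfp k q ts p W pos X =
     (\<chi> i. let j = block_of (pos i)
           in zfp_block k q ts p (W j) (block X j) $ offset_of (pos i))"

end

theory Submission
  imports Defs
begin

text \<open>In a block \<open>y\<close> scaled by \<open>2\<^sup>-\<^sup>l\<close> the conversion to integers costs at most 1, the lossy transform at most
  \<open>7/4\<close> per direction (the exact transform \<open>L\<close> has row sums of absolute values at most 1, so errors of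
  earlier directions are not amplified), and the discarded negabinary planes at most \<open>4/3\<close> times the
  weight of the highest discarded one. The exact inverse amplifies the last two errors by at most
  \<open>(15/4)\<^sup>d\<close>, and \<open>fl\<^sub>k\<close> adds a relative error \<open>\<epsilon>\<^sub>k\<close>. The latter is measured against
  \<open>|y\<^sub>i| < 2 \<cdot> 2\<^sup>e\<close> although the hypothesis only supplies \<open>2\<^sup>e\<close>; the missing factor 2 is absorbed by
  \<open>(15/4)\<^sup>d\<close>.\<close>

section \<open>Sums of powers over sets of exponents\<close>

abbreviation pow_sum :: "real \<Rightarrow> int set \<Rightarrow> real" where
  "pow_sum z A \<equiv> infsum (\<lambda>i. z powi i) A"

lemma has_sum_powi_atMost:
  fixes z :: real
  assumes "\<bar>z\<bar> > 1"
  shows "((\<lambda>i. z powi i) has_sum (z powi m * (z / (z - 1)))) {..m}"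
proof -
  have z: "z \<noteq> 0" "z \<noteq> 1" using assms by auto
  have "(\<lambda>n. (inverse z) ^ n) sums (1 / (1 - inverse z))"
    using assms by (intro geometric_sums) (simp add: field_simps)
  then have "((\<lambda>n. (inverse z) ^ n) has_sum (1 / (1 - inverse z))) UNIV"
  proof (rule norm_summable_imp_has_sum[rotated])
    show "summable (\<lambda>n. norm (inverse z ^ n))"
      unfolding norm_power using assms by (intro summable_geometric) (simp add: field_simps)
  qed
  from has_sum_cmult_right[OF this, of "z powi m"]
  have "((\<lambda>n. z powi m * (inverse z) ^ n) has_sum (z powi m * (1 / (1 - inverse z)))) UNIV" .
  also have "(\<lambda>n. z powi m * (inverse z) ^ n) = (\<lambda>n. z powi (m - int n))"
    using z by (auto simp: power_int_diff field_simps)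
  also have "1 / (1 - inverse z) = z / (z - 1)"
    using z by (simp add: field_simps)
  also have "((\<lambda>n. z powi (m - int n)) has_sum (z powi m * (z / (z - 1)))) UNIV \<longleftrightarrow>
      ((\<lambda>i. z powi i) has_sum (z powi m * (z / (z - 1)))) {..m}"
    by (rule has_sum_reindex_bij_witness[of _ "\<lambda>i. nat (m - i)" "\<lambda>n. m - int n"]) auto
  finally show ?thesis .
qed

lemma powi_summable_bdd_above:
  fixes z :: real
  assumes "\<bar>z\<bar> > 1" "bdd_above A"
  shows "(\<lambda>i. z powi i) summable_on A"
proof -
  obtain m where "A \<subseteq> {..m}"
    using assms(2) by (auto simp: bdd_above_def)
  then show ?thesis
    using has_sum_powi_atMost[OF assms(1)] summable_on_subset_banach has_sum_imp_summable by blast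
qed

lemma powi_le_pow_sum:
  assumes "(\<lambda>i. 2 powi i :: real) summable_on A" "i \<in> A"
  shows "2 powi i \<le> pow_sum 2 A"
  using finite_sum_le_infsum[OF assms(1), of "{i}"] assms(2) by auto

text \<open>Each term is at most the sum, while powers of 2 exceed every bound. Hence summability of
  binary digits amounts to boundedness of their exponents.\<close>

lemma bdd_above_powi_summable:
  assumes "(\<lambda>i. 2 powi i :: real) summable_on A"
  shows "bdd_above A"
proof -
  obtain n where n: "pow_sum 2 A < 2 ^ n"
    using real_arch_pow[of 2] by auto
  have "i \<le> int n" if "i \<in> A" for i
  proof (rule ccontr)
    assume "\<not> ?thesis"
    then have "(2::real) powi int n \<le> 2 powi i"
      by (intro power_int_increasing) auto
    with powi_le_pow_sum[OF assms that] n show False by simp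
  qed
  then show ?thesis by (auto simp: bdd_above_def)
qed

lemma pow_sum_split:
  fixes z :: real
  assumes "(\<lambda>i. z powi i) summable_on A"
  shows "pow_sum z A = pow_sum z (A \<inter> S) + pow_sum z (A - S)"
proof -
  have "A = (A \<inter> S) \<union> (A - S)" by auto
  then show ?thesis
    using infsum_Un_disjoint[of "\<lambda>i. z powi i" "A \<inter> S" "A - S"] assms summable_on_subset_banach
    by (metis Diff_disjoint Diff_subset Int_lower1 inf.assoc inf_bot_right inf_commute)
qed

lemma pow_sum2_le:
  assumes "A \<subseteq> {..m}"
  shows "pow_sum 2 A \<le> 2 powi (m + 1)"
proof -
  have "((\<lambda>i. 2 powi i :: real) has_sum (2 powi (m + 1))) {..m}"
    using has_sum_powi_atMost[of 2 m] by (simp add: power_int_add)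
  then show ?thesis
    using infsum_mono2[of "\<lambda>i. 2 powi i :: real" A "{..m}"] assms summable_on_subset_banach
      has_sum_iff by (metis (no_types, lifting) zero_le_numeral zero_le_power_int)
qed

lemma pow_sum2_nonneg: "pow_sum 2 A \<ge> 0"
  by (rule infsum_nonneg) auto

text \<open>Subtracting \<open>1/2\<close> from every digit subtracts half of the full geometric series and leaves
  coefficients \<open>\<plusminus>1/2\<close>.\<close>

lemma abs_pow_sum_neg2_le:
  assumes "A \<subseteq> {..m}"
  shows "\<bar>pow_sum (-2) A\<bar> \<le> 4 / 3 * 2 powi m"
proof -
  let ?f = "\<lambda>i. (-2) powi i :: real"
  let ?T = "?f m * (2 / 3)"
  have T: "(?f has_sum ?T) {..m}"
    using has_sum_powi_atMost[of "-2" m] by simp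
  have A: "(?f has_sum pow_sum (-2) A) A"
    using assms by (intro has_sum_infsum powi_summable_bdd_above) (auto simp: bdd_above_def)
  have A': "((\<lambda>i. if i \<in> A then ?f i else 0) has_sum pow_sum (-2) A) {..m}"
    using A assms by (subst has_sum_cong_neutral[where T = A and g = ?f]) auto
  let ?g = "\<lambda>i. (if i \<in> A then ?f i else 0) + (-1/2) * ?f i"
  have g: "(?g has_sum (pow_sum (-2) A + (-1/2) * ?T)) {..m}"
    by (intro has_sum_add A' has_sum_cmult_right T)
  have h: "((\<lambda>i. 1/2 * 2 powi i :: real) has_sum (1/2 * (2 powi m * 2))) {..m}"
    using has_sum_powi_atMost[of 2 m] by (intro has_sum_cmult_right) auto
  have "\<bar>pow_sum (-2) A + (-1/2) * ?T\<bar> \<le> 1/2 * (2 powi m * 2)"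
  proof -
    have "norm (infsum ?g {..m}) \<le> infsum (\<lambda>i. 1/2 * 2 powi i :: real) {..m}"
    proof (rule norm_infsum_le[OF _ h[unfolded infsumI[OF h, symmetric]]])
      show "(?g has_sum infsum ?g {..m}) {..m}"
        using g by (simp add: has_sum_iff)
    qed (auto simp: abs_mult power_int_abs)
    then show ?thesis using infsumI[OF g] infsumI[OF h] by simp
  qed
  \<comment> \<open>Half of \<open>?T\<close> contributes \<open>1/3 * 2 powi m\<close>; added to
    the bound \<open>2 powi m\<close> for the centred sum it gives the factor
    \<open>4/3\<close>.\<close>
  moreover have "\<bar>?T\<bar> = 2/3 * 2 powi m"
    by (simp add: abs_mult power_int_abs)
  ultimately show ?thesis by linarith
qed

lemma pow_sum_shift:
  fixes z :: real
  assumes "z \<noteq> 0"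
  shows "pow_sum z {i. i + l \<in> A} = z powi (- l) * pow_sum z A"
proof -
  have "pow_sum z {i. i + l \<in> A} = (\<Sum>\<^sub>\<infinity>i\<in>A. z powi (i - l))"
    by (rule infsum_reindex_bij_witness[where i = "\<lambda>i. i - l" and j = "\<lambda>i. i + l"]) auto
  also have "\<dots> = (\<Sum>\<^sub>\<infinity>i\<in>A. z powi (- l) * z powi i)"
    using assms by (intro infsum_cong) (simp flip: power_int_add)
  also have "\<dots> = z powi (- l) * pow_sum z A"
    by (rule infsum_cmult_right')
  finally show ?thesis .
qed

section \<open>Digit sequences and their supports\<close>

lemma pow_sum_of_bool:
  fixes z :: real
  shows "(\<Sum>\<^sub>\<infinity>i. of_bool (c i) * z powi i) = pow_sum z (supp c)"
    and "(\<lambda>i. of_bool (c i) * z powi i) summable_on UNIV \<longleftrightarrow>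
      (\<lambda>i. z powi i) summable_on supp c"
  by (rule infsum_cong_neutral summable_on_cong_neutral; auto simp: supp_def)+

lemma f_B_eq: "f_B b = (-1) ^ of_bool (fst b) * pow_sum 2 (supp (snd b))"
  by (simp add: f_B_def pow_sum_of_bool)

lemma f_N_eq: "f_N c = pow_sum (-2) (supp c)"
  by (simp add: f_N_def pow_sum_of_bool)

lemma bin_repr_iff:
  "bin_repr x b \<longleftrightarrow> bdd_above (supp (snd b)) \<and> f_B b = x"
  unfolding bin_repr_def pow_sum_of_bool
  using powi_summable_bdd_above[of 2] bdd_above_powi_summable by auto

lemma supp_trunc: "supp (trunc S c) = supp c \<inter> S"
  by (auto simp: supp_def trunc_def)

lemma supp_shift: "supp (shift l c) = {i. i + l \<in> supp c}"
  by (auto simp: supp_def shift_def)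

section \<open>Chosen representations\<close>

lemma of_bool_odd_eq: "of_bool (odd n) = n - 2 * (n div 2)" for n :: int
  by (metis mod_2_eq_odd minus_mult_div_eq_mod)

text \<open>Digit \<open>i\<close> is the parity of the integer part \<open>F i\<close> of
  \<open>x / 2 powi i\<close>. Since \<open>F (i + 1) = F i div 2\<close>, digit sums telescope to
  truncations of \<open>x\<close>, which converge to \<open>x\<close>.\<close>

lemma ex_binary_expansion:
  fixes x :: real
  assumes "x \<ge> 0"
  shows "\<exists>A. bdd_above A \<and> pow_sum 2 A = x"
proof -
  obtain m :: nat where m: "x < 2 ^ m"
    using real_arch_pow[of 2 x] by auto
  define F where "F i = \<lfloor>x / 2 powi i\<rfloor>" for i
  define A where "A = {i. odd (F i)}"
  have F_high: "F i = 0" if "i \<ge> int m" for i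
  proof -
    have "(2::real) powi int m \<le> 2 powi i"
      using that by (intro power_int_increasing) auto
    then have "x < 2 powi i" using m by simp
    then show ?thesis using assms by (simp add: F_def floor_eq_iff)
  qed
  have A_sub: "A \<subseteq> {..int m - 1}"
  proof
    fix i assume "i \<in> A"
    then have "F i \<noteq> 0" by (auto simp: A_def)
    then show "i \<in> {..int m - 1}" using F_high[of i] by fastforce
  qed
  have F_Suc: "F (i + 1) = F i div 2" for i
    using floor_divide_real_eq_div[of 2 "x / 2 powi i"] by (simp add: F_def power_int_add)
  have digit: "of_bool (i \<in> A) * 2 powi i = of_int (F i) * 2 powi i - of_int (F (i + 1)) * (2 powi (i + 1) :: real)"
    for i
  proof -
    have "of_bool (i \<in> A) = F i - 2 * (F i div 2)"
      using of_bool_odd_eq[of "F i"] by (simp add: A_def)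
    then have "of_bool (i \<in> A) = (of_int (F i) - 2 * of_int (F i div 2) :: real)"
      by (metis of_int_diff of_int_mult of_int_numeral of_int_of_bool)
    then show ?thesis
      unfolding F_Suc by (simp only:) (simp add: power_int_add left_diff_distrib)
  qed
  \<comment> \<open>\<open>G n\<close> is \<open>x\<close> rounded down to a multiple of
    \<open>2 powi (m - n)\<close>; it starts at 0 because \<open>x < 2 ^ m\<close>.\<close>
  define G where "G n = of_int (F (int m - int n)) * (2 powi (int m - int n) :: real)" for n
  have "G \<longlonglongrightarrow> x"
  proof (rule real_tendsto_sandwich)
    have pw: "(\<lambda>n. 2 powi (int m - int n) :: real) \<longlonglongrightarrow> 0"
    proof -
      have "(\<lambda>n. 2 ^ m * (1 / 2) ^ n :: real) \<longlonglongrightarrow> 2 ^ m * 0"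
        by (intro tendsto_mult LIMSEQ_realpow_zero) auto
      then show ?thesis by (simp add: power_int_diff power_divide)
    qed
    show "(\<lambda>n. x - 2 powi (int m - int n)) \<longlonglongrightarrow> x"
      using tendsto_diff[OF tendsto_const pw, of x] by simp
    show "\<forall>\<^sub>F n in sequentially. x - 2 powi (int m - int n) \<le> G n"
    proof (intro always_eventually allI)
      fix n
      let ?p = "2 powi (int m - int n) :: real"
      have "(x / ?p - 1) * ?p \<le> of_int \<lfloor>x / ?p\<rfloor> * ?p"
        by (intro mult_right_mono) (linarith, simp)
      then show "x - ?p \<le> G n" by (simp add: G_def F_def algebra_simps)
    qed
    show "\<forall>\<^sub>F n in sequentially. G n \<le> x"
    proof (intro always_eventually allI)
      fix n
      let ?p = "2 powi (int m - int n) :: real"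
      have "of_int \<lfloor>x / ?p\<rfloor> * ?p \<le> (x / ?p) * ?p"
        by (intro mult_right_mono) auto
      then show "G n \<le> x" by (simp add: G_def F_def)
    qed
  qed auto
  then have "(\<lambda>n. G (Suc n) - G n) sums (x - G 0)"
    by (rule telescope_sums)
  moreover have "G 0 = 0" by (simp add: G_def F_high)
  moreover have "G (Suc n) - G n = of_bool (int m - 1 - int n \<in> A) * 2 powi (int m - 1 - int n)" for n
    unfolding digit by (simp add: G_def algebra_simps)
  ultimately have "(\<lambda>n. of_bool (int m - 1 - int n \<in> A) * 2 powi (int m - 1 - int n)) sums x"
    by simp
  \<comment> \<open>Nonnegative terms make the ordered sum unconditional, so it can be reindexed by
    the exponents.\<close>
  then have "((\<lambda>n. of_bool (int m - 1 - int n \<in> A) * 2 powi (int m - 1 - int n)) has_sum x) UNIV"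
    by (intro sums_nonneg_imp_has_sum) auto
  also have "?this \<longleftrightarrow> ((\<lambda>i. of_bool (i \<in> A) * 2 powi i) has_sum x) {..int m - 1}"
    by (rule has_sum_reindex_bij_witness[of _ "\<lambda>i. nat (int m - 1 - i)" "\<lambda>n. int m - 1 - int n"]) auto
  also have "\<dots> \<longleftrightarrow> ((\<lambda>i. 2 powi i) has_sum x) A"
    using A_sub by (intro has_sum_cong_neutral) auto
  finally show ?thesis
    using A_sub by (auto simp: bdd_above_def infsumI intro!: exI[of _ A])
qed

lemma supp_iff: "supp (\<lambda>i. i \<in> A) = A"
  by (simp add: supp_def)

lemma ex_bin_repr: "\<exists>b. bin_repr x b"
proof -
  obtain A where "bdd_above A" "pow_sum 2 A = \<bar>x\<bar>"
    using ex_binary_expansion[of "\<bar>x\<bar>"] by auto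
  then have "bin_repr x (x < 0, \<lambda>i. i \<in> A)"
    by (auto simp: bin_repr_iff f_B_eq supp_iff)
  then show ?thesis ..
qed

text \<open>The choice predicate is satisfiable: by no digits and positive sign for
  \<open>x = 0\<close>, otherwise by a finite representation if there is one and by any
  representation if not.\<close>

lemma f_B_inv_spec:
  "bin_repr x (f_B_inv x) \<and> (x = 0 \<longrightarrow> \<not> fst (f_B_inv x))"
proof -
  let ?P = "\<lambda>b. bin_repr x b \<and> (x = 0 \<longrightarrow> \<not> fst b) \<and>
     ((\<exists>b'. bin_repr x b' \<and> finite (supp (snd b'))) \<longrightarrow> finite (supp (snd b)))"
  have zero: "?P (False, \<lambda>_. False)" if "x = 0"
    using that by (simp add: bin_repr_iff f_B_eq supp_def)
  have "\<exists>b. ?P b"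
    using zero ex_bin_repr[of x] by blast
  then have "?P (f_B_inv x)"
    unfolding f_B_inv_def by (rule someI_ex)
  then show ?thesis by blast
qed

lemma f_B_f_B_inv: "f_B (f_B_inv x) = x"
  and bdd_above_f_B_inv: "bdd_above (supp (snd (f_B_inv x)))"
  using f_B_inv_spec[of x] by (auto simp: bin_repr_iff)

lemma pow_sum_f_B_inv: "pow_sum 2 (supp (snd (f_B_inv x))) = \<bar>x\<bar>"
proof -
  have "\<bar>f_B (f_B_inv x)\<bar> = pow_sum 2 (supp (snd (f_B_inv x)))"
    by (simp add: f_B_eq abs_mult pow_sum2_nonneg)
  then show ?thesis by (simp add: f_B_f_B_inv)
qed

lemma summable_f_B_inv: "(\<lambda>i. 2 powi i :: real) summable_on supp (snd (f_B_inv x))"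
  using bdd_above_f_B_inv by (intro powi_summable_bdd_above) auto

text \<open>A single digit already has positive weight. Hence zero components, padding included, do
  not influence \<open>e_max\<close> of a nonzero vector.\<close>

lemma supp_f_B_inv_eq_empty_iff: "supp (snd (f_B_inv x)) = {} \<longleftrightarrow> x = 0"
proof
  show "x = 0" if "supp (snd (f_B_inv x)) = {}"
    using pow_sum_f_B_inv[of x] that by simp
  show "supp (snd (f_B_inv x)) = {}" if "x = 0"
  proof (rule ccontr)
    assume "supp (snd (f_B_inv x)) \<noteq> {}"
    then obtain i where "i \<in> supp (snd (f_B_inv x))" by auto
    from powi_le_pow_sum[OF summable_f_B_inv this] show False
      using that zero_less_power_int[of "2::real" i] by (simp add: pow_sum_f_B_inv del: zero_less_power_int)
  qed
qed

text \<open>Division by -2 with remainder: \<open>n = of_bool e - 2 * m\<close>, where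
  \<open>\<bar>m\<bar> < \<bar>n\<bar>\<close> once \<open>\<bar>n\<bar> \<ge> 2\<close>. The
  condition \<open>A \<subseteq> {0..}\<close> leaves place 0 free for the remainder after a
  shift.\<close>

lemma ex_negabinary_int:
  "\<exists>A. finite A \<and> A \<subseteq> {0..} \<and> pow_sum (-2) A = of_int n"
proof (induction "nat \<bar>n\<bar>" arbitrary: n rule: less_induct)
  case less
  have step: "\<exists>A. finite A \<and> A \<subseteq> {0..} \<and> pow_sum (-2) A = of_int (of_bool e - 2 * m)"
    if ex: "\<exists>A. finite A \<and> A \<subseteq> {0..} \<and> pow_sum (-2) A = of_int m" for e m
  proof -
    obtain A where A: "finite A" "A \<subseteq> {0..}" "pow_sum (-2) A = of_int m"
      using ex by blast
    define A' where "A' = (\<lambda>i. i + 1) ` A"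
    have "sum (\<lambda>i. (-2::real) powi i) A' = sum (\<lambda>i. (-2) powi (i + 1)) A"
      unfolding A'_def by (subst sum.reindex) auto
    also have "\<dots> = - 2 * sum (\<lambda>i. (-2) powi i) A"
      unfolding sum_distrib_left by (intro sum.cong refl) (simp add: power_int_add)
    also have "sum (\<lambda>i. (-2) powi i) A = (of_int m :: real)"
      using A(1,3) by simp
    finally have A': "sum (\<lambda>i. (-2) powi i) A' = - 2 * (of_int m :: real)" .
    have *: "0 \<notin> A'" "finite A'" "A' \<subseteq> {0..}" using A by (auto simp: A'_def)
    then have **: "pow_sum (-2) (insert 0 A') = 1 + pow_sum (-2) A'"
      by simp
    show ?thesis
    proof (intro exI conjI)
      show "pow_sum (-2) (if e then insert 0 A' else A') = of_int (of_bool e - 2 * m)"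
        using A' * ** by (cases e) simp_all
    qed (use * in simp_all)
  qed
  have zero: "\<exists>A. finite A \<and> A \<subseteq> {0..} \<and> pow_sum (-2) A = of_int 0"
    by (rule exI[of _ "{}"]) simp
  have one: "\<exists>A. finite A \<and> A \<subseteq> {0..} \<and> pow_sum (-2) A = of_int 1"
    using step[OF zero, of True] by simp
  consider "n = 0" | "n = 1" | "n = -1" | "\<bar>n\<bar> \<ge> 2" by linarith
  then show ?case
  proof cases
    case 4
    define m where "m = - (n div 2)"
    have n: "n = of_bool (odd n) - 2 * m"
      using of_bool_odd_eq[of n] by (simp add: m_def)
    have "\<bar>m\<bar> < \<bar>n\<bar>" using 4 unfolding m_def by presburger
    then have "nat \<bar>m\<bar> < nat \<bar>n\<bar>" by linarith
    then have "\<exists>A. finite A \<and> A \<subseteq> {0..} \<and> pow_sum (-2) A = of_int m"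
      by (rule less)
    from step[OF this, of "odd n"] show ?thesis unfolding n[symmetric] .
  next
    case 1 then show ?thesis using zero by blast
  next
    case 2 then show ?thesis using one by blast
  next
    \<comment> \<open>The quotient 1 of -1 has the same absolute value, so the induction hypothesis
      does not apply; the digits of 1 are used directly.\<close>
    case 3
    then have n: "of_bool True - 2 * 1 = n" by simp
    from step[OF one, of True] show ?thesis unfolding n .
  qed
qed

text \<open>A finite expansion exists, so the finiteness clause of the choice takes effect. Integers
  suffice, since only transform coefficients are converted to negabinary.\<close>

lemma
  shows f_N_f_N_inv_of_int: "f_N (f_N_inv (of_int n)) = of_int n"
    and finite_f_N_inv_of_int: "finite (supp (f_N_inv (of_int n)))"
proof -
  obtain A where A: "finite A" "pow_sum (-2) A = of_int n"
    using ex_negabinary_int by blast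
  let ?P = "\<lambda>c. negabin_repr (of_int n) c \<and>
     ((\<exists>c'. negabin_repr (of_int n) c' \<and> finite (supp c')) \<longrightarrow> finite (supp c))"
  have *: "negabin_repr (of_int n) (\<lambda>i. i \<in> A)"
    using A unfolding negabin_repr_def pow_sum_of_bool by (simp add: f_N_eq supp_iff)
  then have "?P (\<lambda>i. i \<in> A)" using A(1) by (simp add: supp_iff)
  then have P: "?P (f_N_inv (of_int n))"
    unfolding f_N_inv_def by (rule someI[of ?P])
  then show "f_N (f_N_inv (of_int n)) = of_int n"
    by (simp add: negabin_repr_def)
  show "finite (supp (f_N_inv (of_int n)))"
    using P * A(1) by (metis supp_iff)
qed

lemma f_N_trunc_error:
  "\<bar>f_N (trunc {i. i > m} (f_N_inv (of_int n))) - of_int n\<bar> \<le> 4 / 3 * 2 powi m"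
proof -
  let ?A = "supp (f_N_inv (of_int n))"
  have "of_int n = pow_sum (-2) ?A"
    using f_N_f_N_inv_of_int[of n] by (simp add: f_N_eq)
  also have "\<dots> = pow_sum (-2) (?A \<inter> {i. i > m}) + pow_sum (-2) (?A - {i. i > m})"
    by (rule pow_sum_split) (simp add: finite_f_N_inv_of_int)
  finally have "f_N (trunc {i. i > m} (f_N_inv (of_int n))) - of_int n = - pow_sum (-2) (?A - {i. i > m})"
    by (simp add: f_N_eq supp_trunc)
  then show ?thesis
    using abs_pow_sum_neg2_le[of "?A - {i. i > m}" m] by (simp add: subset_iff)
qed

text \<open>The digits below a leading one at \<open>m\<close> would have to cancel
  \<open>2 powi m\<close>, but they reach at most \<open>4/3 * 2 powi (m - 1)\<close>, two thirds of
  it.\<close>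

lemma supp_f_N_inv_0: "supp (f_N_inv 0) = {}"
proof (rule ccontr)
  let ?A = "supp (f_N_inv 0)"
  assume ne: "?A \<noteq> {}"
  have fin: "finite ?A" and s: "pow_sum (-2) ?A = 0"
    using f_N_f_N_inv_of_int[of 0] finite_f_N_inv_of_int[of 0] by (simp_all add: f_N_eq)
  define m where "m = Max ?A"
  have m: "m \<in> ?A" "\<And>i. i \<in> ?A \<Longrightarrow> i \<le> m"
    using fin ne by (auto simp: m_def)
  have "pow_sum (-2) ?A = pow_sum (-2) (?A \<inter> {m}) + pow_sum (-2) (?A - {m})"
    by (rule pow_sum_split) (simp add: fin)
  also have "?A \<inter> {m} = {m}" using m by auto
  finally have "pow_sum (-2) (?A - {m}) = - ((-2) powi m)" using s by simp
  moreover have "\<bar>pow_sum (-2) (?A - {m})\<bar> \<le> 4 / 3 * 2 powi (m - 1)"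
    using m(2) by (intro abs_pow_sum_neg2_le) force
  ultimately show False by (simp add: power_int_diff power_int_abs)
qed

section \<open>Kronecker products and the lossy transform\<close>

text \<open>A separate factor for each direction lets \<open>L_mat\<close> act in some directions
  and the identity in the others, as in a partially processed block.\<close>

definition kron :: "('d::finite \<Rightarrow> real ^ 'n::finite ^ 'n) \<Rightarrow> real ^ ('d \<Rightarrow> 'n) ^ ('d \<Rightarrow> 'n)" where
  "kron A = (\<chi> i j. \<Prod>t\<in>UNIV. A t $ i t $ j t)"

lemma sum_prod_fun:
  fixes f :: "'d::finite \<Rightarrow> 'n::finite \<Rightarrow> real"
  shows "(\<Sum>j\<in>UNIV. \<Prod>t\<in>UNIV. f t (j t)) = (\<Prod>t\<in>UNIV. \<Sum>m\<in>UNIV. f t m)"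
  using prod_sum_PiE[of "UNIV :: 'd set" "\<lambda>_. UNIV :: 'n set" f] by (simp add: PiE_UNIV_domain)

lemma kron_mult: "kron A ** kron B = kron (\<lambda>t. A t ** B t)"
  by (simp add: kron_def matrix_matrix_mult_def vec_eq_iff prod.distrib flip: sum_prod_fun)

lemma kron_mat_1: "kron (\<lambda>_::'d::finite. mat 1 :: real ^ 'n::finite ^ 'n) = mat 1"
proof -
  have "(\<Prod>t\<in>UNIV. if i t = j t then 1 else 0) = (if i = j then 1 else 0 :: real)"
    for i j :: "'d \<Rightarrow> 'n"
    by (auto simp: fun_eq_iff intro!: prod_zero)
  then show ?thesis by (simp only: kron_def mat_def vec_eq_iff vec_lambda_beta simp_thms)
qed

text \<open>Absolute row sums factor over the directions, which reduces maximum norm estimates to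
  the 4 by 4 factors.\<close>

lemma kron_row_sum_le:
  assumes "\<And>t i. (\<Sum>j\<in>UNIV. \<bar>A t $ i $ j\<bar>) \<le> c t"
  shows "(\<Sum>j\<in>UNIV. \<bar>kron A $ i $ j\<bar>) \<le> (\<Prod>t\<in>UNIV. c t)"
proof -
  have "(\<Sum>j\<in>UNIV. \<bar>kron A $ i $ j\<bar>) = (\<Prod>t\<in>UNIV. \<Sum>m\<in>UNIV. \<bar>A t $ i t $ m\<bar>)"
    by (simp add: kron_def abs_prod flip: sum_prod_fun)
  also have "\<dots> \<le> (\<Prod>t\<in>UNIV. c t)"
    using assms by (intro prod_mono) (auto intro: sum_nonneg)
  finally show ?thesis .
qed

lemma matrix_vector_mult_bound:
  fixes A :: "real ^ 'n ^ 'm"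
  assumes "(\<Sum>j\<in>UNIV. \<bar>A $ i $ j\<bar>) \<le> r" "\<And>j. \<bar>v $ j\<bar> \<le> e"
  shows "\<bar>(A *v v) $ i\<bar> \<le> r * e"
proof -
  have "e \<ge> 0" using assms(2) abs_ge_zero order_trans by blast
  have "\<bar>(A *v v) $ i\<bar> \<le> (\<Sum>j\<in>UNIV. \<bar>A $ i $ j * v $ j\<bar>)"
    unfolding matrix_vector_mult_def by simp
  also have "\<dots> \<le> (\<Sum>j\<in>UNIV. \<bar>A $ i $ j\<bar> * e)"
    unfolding abs_mult by (intro sum_mono mult_left_mono assms(2)) auto
  also have "\<dots> \<le> r * e"
    unfolding sum_distrib_right[symmetric] using assms(1) \<open>e \<ge> 0\<close> by (rule mult_right_mono)
  finally show ?thesis .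
qed

section \<open>The exact inverse transform\<close>

lemma vector_4:
  "vector [w, x, y, z] $ (1::4) = (w :: 'a::zero)"
  "vector [w, x, y, z] $ (2::4) = x"
  "vector [w, x, y, z] $ (3::4) = y"
  "vector [w, x, y, z] $ (4::4) = z"
  unfolding vector_def by simp_all

text \<open>The exact inverse of \<open>L_mat\<close>. Each row has absolute sum
  \<open>15/4\<close>, the amplification per direction.\<close>

definition L_inv :: "real ^ 4 ^ 4" where
  "L_inv = (1 / 4) *\<^sub>R vector
     [vector [4,  6, -4, -1],
      vector [4,  2,  4,  5],
      vector [4, -2,  4, -5],
      vector [4, -6, -4,  1]]"

lemma L_mat_inverse: "L_mat ** L_inv = mat 1" "L_inv ** L_mat = mat 1"
  by (simp_all add: L_mat_def L_inv_def matrix_matrix_mult_def mat_def vec_eq_iff forall_4 sum_4 vector_4)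

lemma L_kron_eq: "L_kron = kron (\<lambda>_. L_mat)"
  by (simp add: L_kron_def kron_def)

text \<open>By \<open>kron_mult\<close> the factors are inverted separately. As
  \<open>matrix_inv\<close> is a chosen two-sided inverse, uniqueness of inverses identifies
  it.\<close>

lemma
  shows L_kron_inv_mult: "kron (\<lambda>_::'d::finite. L_inv) ** L_kron = mat 1"
    and matrix_inv_L_kron: "matrix_inv L_kron = kron (\<lambda>_::'d. L_inv)"
proof -
  have *: "L_kron ** kron (\<lambda>_::'d. L_inv) = mat 1" "kron (\<lambda>_::'d. L_inv) ** L_kron = mat 1"
    by (simp_all add: L_kron_eq kron_mult L_mat_inverse kron_mat_1)
  show "kron (\<lambda>_::'d. L_inv) ** L_kron = mat 1" by fact
  from * have "matrix_inv L_kron ** L_kron = (mat 1 :: real ^ ('d \<Rightarrow> 4) ^ ('d \<Rightarrow> 4))"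
    unfolding matrix_inv_def
    by (rule someI[of "\<lambda>A. L_kron ** A = mat 1 \<and> A ** L_kron = mat 1", OF conjI, THEN conjunct2])
  then have "matrix_inv L_kron ** (L_kron ** kron (\<lambda>_. L_inv)) = kron (\<lambda>_::'d. L_inv)"
    by (simp add: matrix_mul_assoc)
  then show "matrix_inv L_kron = kron (\<lambda>_::'d. L_inv)" by (simp add: *)
qed

lemma matrix_inv_L_kron_bound:
  fixes v :: "real ^ ('d::finite \<Rightarrow> 4)"
  assumes "\<And>j. \<bar>v $ j\<bar> \<le> e"
  shows "\<bar>(matrix_inv L_kron *v v) $ i\<bar> \<le> (15 / 4) ^ CARD('d) * e"
proof -
  have "(\<Sum>j\<in>UNIV. \<bar>L_inv $ i $ j\<bar>) \<le> 15 / 4" for i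
  proof -
    have "\<forall>i. (\<Sum>j\<in>UNIV. \<bar>L_inv $ i $ j\<bar>) \<le> 15 / 4"
      unfolding forall_4 sum_4 by (simp add: L_inv_def vector_4)
    then show ?thesis by blast
  qed
  then have "(\<Sum>j\<in>UNIV. \<bar>kron (\<lambda>_::'d. L_inv) $ i $ j\<bar>) \<le> (\<Prod>t\<in>(UNIV::'d set). 15 / 4)"
    by (rule kron_row_sum_le)
  then show ?thesis
    unfolding matrix_inv_L_kron by (intro matrix_vector_mult_bound assms) simp
qed

text \<open>The exact counterpart of having processed the directions in \<open>S\<close>: the
  identity for \<open>{}\<close>, \<open>L_kron\<close> for \<open>UNIV\<close>.\<close>

abbreviation kron_along :: "'d set \<Rightarrow> real ^ ('d::finite \<Rightarrow> 4) ^ ('d \<Rightarrow> 4)" where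
  "kron_along S \<equiv> kron (\<lambda>s. if s \<in> S then L_mat else mat 1)"

text \<open>The absolute row sums of \<open>L_mat\<close> are at most 1. This makes the errors of
  successive directions add up instead of multiplying.\<close>

lemma kron_along_bound:
  assumes "\<And>j. \<bar>v $ j\<bar> \<le> e"
  shows "\<bar>(kron_along (S :: 'd::finite set) *v v) $ i\<bar> \<le> e"
proof -
  have "(\<Sum>j\<in>UNIV. \<bar>(if s \<in> S then L_mat else mat 1) $ i $ j\<bar>) \<le> (1::real)" for s i
  proof -
    have "\<forall>i. (\<Sum>j\<in>UNIV. \<bar>L_mat $ i $ j\<bar>) \<le> 1"
      unfolding forall_4 sum_4 by (simp add: L_mat_def vector_4)
    moreover have "\<forall>i. (\<Sum>j\<in>UNIV. \<bar>(mat 1 :: real ^ 4 ^ 4) $ i $ j\<bar>) \<le> 1"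
      unfolding forall_4 sum_4 by (simp add: mat_def)
    ultimately show ?thesis by auto
  qed
  then have "(\<Sum>j\<in>UNIV. \<bar>kron_along S $ i $ j\<bar>) \<le> (\<Prod>t\<in>(UNIV :: 'd set). 1)"
    by (rule kron_row_sum_le[of "\<lambda>s. if s \<in> S then L_mat else mat 1" "\<lambda>_. 1"])
  then have "\<bar>(kron_along S *v v) $ i\<bar> \<le> 1 * e"
    by (intro matrix_vector_mult_bound assms) simp
  then show ?thesis by simp
qed

text \<open>Off direction \<open>t\<close> the factors are identities, so only the multi-indices
  that agree with \<open>i\<close> there contribute.\<close>

lemma kron_along_singleton_mult:
  "(kron_along {t} *v x) $ i = (\<Sum>m\<in>UNIV. L_mat $ i t $ m * x $ (i(t := m)))"
proof -
  let ?A = "\<lambda>s. if s \<in> {t} then L_mat else mat 1"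
  have "(kron_along {t} *v x) $ i = (\<Sum>j\<in>UNIV. kron ?A $ i $ j * x $ j)"
    by (simp add: matrix_vector_mult_def)
  also have "\<dots> = (\<Sum>j\<in>range (\<lambda>m. i(t := m)). kron ?A $ i $ j * x $ j)"
  proof (rule sum.mono_neutral_right)
    show "\<forall>j\<in>UNIV - range (\<lambda>m. i(t := m)). kron ?A $ i $ j * x $ j = 0"
    proof
      fix j assume "j \<in> UNIV - range (\<lambda>m. i(t := m))"
      then have "j \<noteq> i(t := j t)" by auto
      then obtain s where "s \<noteq> t" "j s \<noteq> i s" by (metis fun_upd_apply ext)
      then have "?A s $ i s $ j s = 0" by (simp add: mat_def)
      then have "\<exists>s\<in>UNIV. ?A s $ i s $ j s = 0" by blast
      then have "kron ?A $ i $ j = 0"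
        unfolding kron_def vec_lambda_beta by (rule prod_zero[OF finite])
      then show "kron ?A $ i $ j * x $ j = 0" by simp
    qed
  qed auto
  also have "\<dots> = (\<Sum>m\<in>UNIV. kron ?A $ i $ (i(t := m)) * x $ (i(t := m)))"
    by (subst sum.reindex) (auto simp: inj_on_def fun_eq_iff split: if_splits)
  also have "\<dots> = (\<Sum>m\<in>UNIV. L_mat $ i t $ m * x $ (i(t := m)))"
  proof (intro sum.cong refl)
    fix m
    have "kron ?A $ i $ (i(t := m)) = (\<Prod>s\<in>{t}. ?A s $ i s $ (i(t := m)) s)"
      unfolding kron_def vec_lambda_beta
      by (rule prod.mono_neutral_right) (auto simp: mat_def)
    then show "kron ?A $ i $ (i(t := m)) * x $ (i(t := m)) = L_mat $ i t $ m * x $ (i(t := m))"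
      by simp
  qed
  finally show ?thesis .
qed

lemma kron_along_insert: "t \<notin> S \<Longrightarrow> kron_along (insert t S) = kron_along {t} ** kron_along S"
  unfolding kron_mult by (rule arg_cong[of _ _ kron]) (auto simp: fun_eq_iff)

section \<open>Rounding errors of the lossy transform\<close>

lemma half_bounds: "real_of_int x - 1 \<le> 2 * real_of_int (half x)" "2 * real_of_int (half x) \<le> real_of_int x"
proof -
  have "half x = x div 2"
    using floor_divide_of_int_eq[of x 2, where ?'a = real] by (simp add: half_def)
  then have "x - 1 \<le> 2 * half x" "2 * half x \<le> x" by presburger+
  then show "real_of_int x - 1 \<le> 2 * real_of_int (half x)" "2 * real_of_int (half x) \<le> real_of_int x"
    by linarith+
qed

text \<open>Without rounding the assignments compute \<open>L_mat\<close> exactly. Each of the six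
  halvings loses between 0 and \<open>1/2\<close>; propagated linearly, this gives at most
  \<open>23/16\<close> in the second coefficient and at most 1 in the others.\<close>

lemma L_lossy_error:
  fixes a :: "int ^ 4"
  shows "\<bar>of_int (L_lossy a $ i) - (\<Sum>m\<in>UNIV. L_mat $ i $ m * of_int (a $ m))\<bar> \<le> 7 / 4"
proof -
  define a1 a2 a3 a4 where a: "a1 = a $ 1" "a2 = a $ 2" "a3 = a $ 3" "a4 = a $ 4"
  define s1 where "s1 = half (a1 + a4)"
  define s3 where "s3 = half (a3 + a2)"
  define t1 where "t1 = half (s1 + s3)"
  define t4 where "t4 = half ((a4 - s1) + (a2 - s3))"
  define h2 where "h2 = half ((a2 - s3) - t4)"
  define h4 where "h4 = half (t4 + h2)"
  have L: "L_lossy a = vector [t1, (a2 - s3) - t4 - h4, s3 - t1, t4 + h2]"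
    unfolding L_lossy_def Let_def
    by (simp add: a s1_def s3_def t1_def t4_def h2_def h4_def)
  note h = half_bounds[of "a1 + a4", folded s1_def] half_bounds[of "a3 + a2", folded s3_def]
    half_bounds[of "s1 + s3", folded t1_def] half_bounds[of "(a4 - s1) + (a2 - s3)", folded t4_def]
    half_bounds[of "(a2 - s3) - t4", folded h2_def] half_bounds[of "t4 + h2", folded h4_def]
  have "\<forall>i. \<bar>of_int (L_lossy a $ i) - (\<Sum>m\<in>UNIV. L_mat $ i $ m * of_int (a $ m))\<bar> \<le> 7 / 4"
    unfolding forall_4 sum_4 L vector_4 L_mat_def a[symmetric] vector_scaleR_component
      real_scaleR_def abs_le_iff
    using h by (simp only: of_int_add of_int_diff) linarith
  then show ?thesis ..
qed

lemma L_lossy_along_error: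
  "\<bar>of_int (L_lossy_along t a $ i) - (kron_along {t} *v (\<chi> j. of_int (a $ j))) $ i\<bar> \<le> 7 / 4"
  unfolding kron_along_singleton_mult
  using L_lossy_error[of "\<chi> m. a $ (i(t := m))" "i t"]
  by (simp add: L_lossy_along_def)

lemma fold_L_lossy_along_error:
  fixes a :: "int ^ ('d::finite \<Rightarrow> 4)"
  assumes "distinct ts"
  shows "\<bar>of_int (fold L_lossy_along ts a $ i) - (kron_along (set ts) *v (\<chi> j. of_int (a $ j))) $ i\<bar>
    \<le> 7 / 4 * length ts"
  using assms
\<comment> \<open>Induction from the right follows \<open>fold\<close>: the old error passes through
  \<open>kron_along {t}\<close> without growth, and the last direction adds
  \<open>7/4\<close>.\<close>
proof (induction ts arbitrary: i rule: rev_induct)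
  case Nil
  then show ?case by (simp add: kron_mat_1)
next
  case (snoc t ts)
  let ?a = "\<chi> j. real_of_int (a $ j)"
  have t: "t \<notin> set ts" using snoc.prems by simp
  define b where "b = fold L_lossy_along ts a"
  let ?b = "\<chi> j. real_of_int (b $ j)"
  let ?c = "kron_along (set ts) *v ?a"
  have "\<bar>(?b - ?c) $ j\<bar> \<le> 7 / 4 * length ts" for j
    using snoc by (simp add: b_def)
  then have "\<bar>(kron_along {t} *v (?b - ?c)) $ i\<bar> \<le> 7 / 4 * length ts"
    by (rule kron_along_bound)
  also have "kron_along {t} *v (?b - ?c) =
      kron_along {t} *v ?b - kron_along (insert t (set ts)) *v ?a"
    unfolding kron_along_insert[OF t]
    by (simp only: matrix_vector_mult_diff_distrib matrix_vector_mul_assoc)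
  finally have "\<bar>(kron_along {t} *v ?b) $ i - (kron_along (set (ts @ [t])) *v ?a) $ i\<bar> \<le> 7 / 4 * length ts"
    unfolding set_append list.set Un_insert_right Un_empty_right vector_minus_component .
  moreover have "fold L_lossy_along (ts @ [t]) a = L_lossy_along t b"
    by (simp add: b_def)
  moreover have "7 / 4 * real (length (ts @ [t])) = 7 / 4 * length ts + 7 / 4"
    by (simp add: field_simps)
  ultimately show ?case
    using L_lossy_along_error[of t b i] by (simp only:)
qed

lemma L_lossy_d_error:
  fixes a :: "int ^ ('d::finite \<Rightarrow> 4)"
  assumes "distinct ts" "set ts = UNIV"
  shows "\<bar>of_int (L_lossy_d ts a $ i) - (L_kron *v (\<chi> j. of_int (a $ j))) $ i\<bar> \<le> 7 / 4 * CARD('d)"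
proof -
  have "length ts = CARD('d)" using assms distinct_card by metis
  then show ?thesis
    using fold_L_lossy_along_error[OF assms(1), of a i] assms(2)
    by (simp add: L_lossy_d_def L_kron_eq)
qed

section \<open>Error of one block\<close>

lemma Sup_int_mem:
  fixes A :: "int set"
  assumes "A \<noteq> {}" "bdd_above A"
  shows "Sup A \<in> A"
proof -
  obtain x where "x \<in> A" "Sup A - 1 < x"
    using less_cSup_iff[OF assms, of "Sup A - 1"] by auto
  moreover have "x \<le> Sup A"
    using \<open>x \<in> A\<close> assms(2) by (rule cSup_upper)
  ultimately show ?thesis by (metis diff_add_cancel order_antisym zless_imp_add1_zle)
qed

lemma f_B_shift: "f_B (apsnd (shift l) b) = 2 powi (- l) * f_B b"
  by (simp add: f_B_eq supp_shift pow_sum_shift)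

text \<open>All digits of a number share its sign, so the discarded weight is the exact
  error.\<close>

lemma f_B_trunc_error:
  assumes "bdd_above (supp (snd b))"
  shows "\<bar>f_B (apsnd (trunc S) b) - f_B b\<bar> = pow_sum 2 (supp (snd b) - S)"
proof -
  have "pow_sum 2 (supp (snd b)) = pow_sum 2 (supp (snd b) \<inter> S) + pow_sum 2 (supp (snd b) - S)"
    by (intro pow_sum_split powi_summable_bdd_above assms) simp
  then have "f_B (apsnd (trunc S) b) - f_B b = - ((-1) ^ of_bool (fst b) * pow_sum 2 (supp (snd b) - S))"
    by (simp add: f_B_eq supp_trunc algebra_simps)
  then show ?thesis by (simp add: abs_mult pow_sum2_nonneg)
qed

text \<open>The dropped digits weigh at most \<open>eps k * 2 powi Sup ?A\<close>, and the leading
  digit shows \<open>2 powi Sup ?A \<le> \<bar>a\<bar>\<close>.\<close>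

lemma keep_leading_error:
  "\<bar>f_B (apsnd (keep_leading k) (f_B_inv a)) - a\<bar> \<le> eps (int k) * \<bar>a\<bar>"
proof -
  let ?A = "supp (snd (f_B_inv a))"
  let ?S = "{j. j > Sup ?A - int k}"
  have eq: "apsnd (keep_leading k) (f_B_inv a) = apsnd (trunc ?S) (f_B_inv a)"
    by (cases "f_B_inv a") (simp add: keep_leading_def)
  have *: "\<bar>f_B (apsnd (keep_leading k) (f_B_inv a)) - a\<bar> = pow_sum 2 (?A - ?S)"
    unfolding eq using f_B_trunc_error[OF bdd_above_f_B_inv, of ?S a] by (simp only: f_B_f_B_inv)
  show ?thesis
  proof (cases "?A = {}")
    \<comment> \<open>Here the supremum is unspecified, but there is no digit to drop.\<close>
    case True
    then show ?thesis unfolding * by (simp add: eps_def)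
  next
    case False
    have "?A - ?S \<subseteq> {..Sup ?A - int k}" by auto
    then have "pow_sum 2 (?A - ?S) \<le> 2 powi (Sup ?A - int k + 1)"
      by (rule pow_sum2_le)
    also have "Sup ?A - int k + 1 = (1 - int k) + Sup ?A" by simp
    also have "2 powi \<dots> = eps (int k) * 2 powi Sup ?A"
      unfolding eps_def by (rule power_int_add) simp
    also have "\<dots> \<le> eps (int k) * \<bar>a\<bar>"
      using powi_le_pow_sum[OF summable_f_B_inv Sup_int_mem[OF False bdd_above_f_B_inv]]
      unfolding pow_sum_f_B_inv by (intro mult_left_mono) (simp_all add: eps_def)
    finally show ?thesis unfolding * .
  qed
qed

lemma bdd_above_e_max: "bdd_above (\<Union>i. supp (snd (f_B_inv ((y :: real ^ 'm::finite) $ i))))"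
  by (simp add: bdd_above_f_B_inv)

lemma abs_le_e_max:
  fixes y :: "real ^ 'm::finite"
  shows "\<bar>y $ i\<bar> \<le> 2 powi (e_max y + 1)"
proof -
  have "supp (snd (f_B_inv (y $ i))) \<subseteq> {..e_max y}"
    unfolding e_max_def using cSup_upper[OF _ bdd_above_e_max[of y]] by blast
  from pow_sum2_le[OF this] show ?thesis by (simp add: pow_sum_f_B_inv)
qed

text \<open>Zeros have no digits, so all exponents in \<open>y\<close> occur in \<open>x\<close>;
  \<open>y \<noteq> 0\<close> makes the supremum range over a nonempty set.\<close>

lemma e_max_mono:
  fixes x :: "real ^ 'n::finite" and y :: "real ^ 'm::finite"
  assumes "y \<noteq> 0" "\<And>i. y $ i = 0 \<or> (\<exists>j. y $ i = x $ j)"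
  shows "e_max y \<le> e_max x"
  unfolding e_max_def
proof (rule cSup_subset_mono[OF _ bdd_above_e_max])
  obtain i where "y $ i \<noteq> 0" using assms(1) by (auto simp: vec_eq_iff)
  then have "supp (snd (f_B_inv (y $ i))) \<noteq> {}"
    by (simp add: supp_f_B_inv_eq_empty_iff)
  then show "(\<Union>i. supp (snd (f_B_inv (y $ i)))) \<noteq> {}" by blast
  show "(\<Union>i. supp (snd (f_B_inv (y $ i)))) \<subseteq> (\<Union>i. supp (snd (f_B_inv (x $ i))))"
  proof
    fix t assume "t \<in> (\<Union>i. supp (snd (f_B_inv (y $ i))))"
    then obtain i where i: "t \<in> supp (snd (f_B_inv (y $ i)))" by blast
    then have "y $ i \<noteq> 0" using supp_f_B_inv_eq_empty_iff[of "y $ i"] by auto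
    then obtain j where "y $ i = x $ j" using assms(2) by blast
    then show "t \<in> (\<Union>i. supp (snd (f_B_inv (x $ i))))" using i by auto
  qed
qed

section \<open>Conversion to integers\<close>

lemma to_integers_component:
  "to_integers q y $ i = apsnd (trunc {i. i \<ge> 0}) (apsnd (shift (block_exponent q y)) (f_B_inv (y $ i)))"
  by (simp add: to_integers_def vmap_def apsnd_compose)

text \<open>Finitely many exponents survive, all nonnegative. Thus the floor in
  \<open>forward_transform\<close> changes nothing.\<close>

lemma to_integers_in_Ints:
  fixes y :: "real ^ 'm::finite"
  shows "f_B (to_integers q y $ i) \<in> \<int>"
proof -
  define A where "A = {j. j + block_exponent q y \<in> supp (snd (f_B_inv (y $ i)))} \<inter> {j. j \<ge> 0}"
  obtain m where "\<And>j. j \<in> supp (snd (f_B_inv (y $ i))) \<Longrightarrow> j \<le> m"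
    using bdd_above_f_B_inv by (meson bdd_above_def)
  then have "A \<subseteq> {0..m - block_exponent q y}"
    by (force simp: A_def)
  then have "finite A" by (rule finite_subset) simp
  moreover have "(2::real) powi j \<in> \<int>" if "j \<in> A" for j
    using that by (auto simp: A_def power_int_def)
  ultimately have "pow_sum 2 A \<in> \<int>" by (auto intro: Ints_sum)
  then show ?thesis
    by (simp add: to_integers_component f_B_eq supp_trunc supp_shift A_def)
qed

lemma to_integers_error:
  fixes y :: "real ^ 'm::finite"
  shows "\<bar>f_B (to_integers q y $ i) - y $ i * 2 powi (- block_exponent q y)\<bar> \<le> 1"
proof -
  let ?b = "apsnd (shift (block_exponent q y)) (f_B_inv (y $ i))"
  obtain m where "\<And>j. j \<in> supp (snd (f_B_inv (y $ i))) \<Longrightarrow> j \<le> m"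
    using bdd_above_f_B_inv by (meson bdd_above_def)
  then have bdd: "bdd_above (supp (snd ?b))"
    by (intro bdd_aboveI[of _ "m - block_exponent q y"]) (force simp: supp_shift)
  have "f_B ?b = y $ i * 2 powi (- block_exponent q y)"
    by (simp add: f_B_shift f_B_f_B_inv)
  then have "\<bar>f_B (to_integers q y $ i) - y $ i * 2 powi (- block_exponent q y)\<bar> =
      pow_sum 2 (supp (snd ?b) - {i. i \<ge> 0})"
    using f_B_trunc_error[OF bdd, of "{i. i \<ge> 0}"] by (simp only: to_integers_component)
  \<comment> \<open>The highest discarded exponent is -1.\<close>
  also have "\<dots> \<le> 2 powi (-1 + 1)"
    by (rule pow_sum2_le) auto
  finally show ?thesis by simp
qed

text \<open>The conversions \<open>f_B\<close>, \<open>f_B_inv\<close> cancel, and so do the two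
  permutations, because bit planes are removed in each component alone. The shift back becomes a
  factor.\<close>

lemma zfp_block_component:
  fixes y :: "real ^ ('d::finite \<Rightarrow> 4)" and q :: nat and ts :: "'d list" and w :: int
  assumes "bij p"
  defines "z \<equiv> L_lossy_d ts (\<chi> j. \<lfloor>f_B (to_integers q y $ j)\<rfloor>)"
  defines "g \<equiv> matrix_inv L_kron *v (\<chi> j. f_N (trunc {i. i > int q + 1 - w} (f_N_inv (of_int (z $ j)))))"
  shows "zfp_block k q ts p w y $ i =
    2 powi block_exponent q y * f_B (apsnd (keep_leading k) (f_B_inv (g $ i)))"
proof -
  have "p (inv p j) = j" for j
    using assms(1) by (simp add: bij_is_surj surj_f_inv_f)
  then have "zfp_block k q ts p w y $ i =
      f_B (apsnd (shift (- block_exponent q y)) (apsnd (keep_leading k) (f_B_inv (g $ i))))"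
    unfolding zfp_block_def decompress_block_def compress_block_def forward_transform_def
      permute_comps_def vmap_def Let_def
    by (simp add: f_B_f_B_inv g_def z_def apsnd_compose)
  then show ?thesis by (simp add: f_B_shift)
qed

lemma zfp_block_error:
  fixes y :: "real ^ ('d::finite \<Rightarrow> 4)"
  assumes "bij p" "distinct ts" "set ts = UNIV"
  shows "\<bar>zfp_block k q ts p w y $ i - y $ i\<bar> \<le>
    2 powi block_exponent q y * ((1 + eps (int k)) *
      (1 + (15 / 4) ^ CARD('d) * (7 / 4 * CARD('d) + 4 / 3 * 2 powi (int q + 1 - w))))
    + eps (int k) * \<bar>y $ i\<bar>"
proof -
  define l where "l = block_exponent q y"
  define a where "a = (\<chi> j. \<lfloor>f_B (to_integers q y $ j)\<rfloor>)"
  define a' where "a' = (\<chi> j. real_of_int (a $ j))"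
  define z where "z = L_lossy_d ts a"
  define z' where "z' = (\<chi> j. f_N (trunc {i. i > int q + 1 - w} (f_N_inv (of_int (z $ j)))))"
  define g where "g = matrix_inv L_kron *v z'"
  define u where "u = y $ i * 2 powi (- l)"
  define R where "R = 7 / 4 * CARD('d) + 4 / 3 * 2 powi (int q + 1 - w)"
  have y: "y $ i = 2 powi l * u"
    by (simp add: u_def power_int_minus)
  have out: "zfp_block k q ts p w y $ i = 2 powi l * f_B (apsnd (keep_leading k) (f_B_inv (g $ i)))"
    unfolding zfp_block_component[OF assms(1)] l_def g_def z'_def z_def a_def ..
  have a': "a' $ j = f_B (to_integers q y $ j)" for j
    using to_integers_in_Ints[of q y j] by (simp add: a'_def a_def)
  have "\<bar>(z' - L_kron *v a') $ j\<bar> \<le> R" for j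
  proof -
    have "\<bar>z' $ j - of_int (z $ j)\<bar> \<le> 4 / 3 * 2 powi (int q + 1 - w)"
      unfolding z'_def vec_lambda_beta by (rule f_N_trunc_error)
    moreover have "\<bar>of_int (z $ j) - (L_kron *v a') $ j\<bar> \<le> 7 / 4 * CARD('d)"
      unfolding z_def a'_def by (intro L_lossy_d_error assms)
    ultimately show ?thesis unfolding R_def vector_minus_component by linarith
  qed
  then have "\<bar>(matrix_inv L_kron *v (z' - L_kron *v a')) $ i\<bar> \<le> (15 / 4) ^ CARD('d) * R"
    by (rule matrix_inv_L_kron_bound)
  \<comment> \<open>The exact inverse restores \<open>a'\<close>, so it amplifies \<open>R\<close>
    but not the error of the conversion to integers.\<close>
  also have "matrix_inv L_kron *v (z' - L_kron *v a') = g - a'"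
    unfolding g_def matrix_vector_mult_diff_distrib
    by (simp add: matrix_vector_mul_assoc matrix_inv_L_kron L_kron_inv_mult)
  finally have ga: "\<bar>g $ i - a' $ i\<bar> \<le> (15 / 4) ^ CARD('d) * R" by simp
  moreover have "\<bar>a' $ i - u\<bar> \<le> 1"
    unfolding a' u_def l_def by (rule to_integers_error)
  ultimately have gu: "\<bar>g $ i - u\<bar> \<le> 1 + (15 / 4) ^ CARD('d) * R" by linarith
  have "\<bar>f_B (apsnd (keep_leading k) (f_B_inv (g $ i))) - g $ i\<bar> \<le> eps (int k) * \<bar>g $ i\<bar>"
    by (rule keep_leading_error)
  \<comment> \<open>The error of \<open>keep_leading\<close> is relative to \<open>g $ i\<close>;
    comparison with \<open>u\<close> puts the factor \<open>1 + eps k\<close> on the earlier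
    errors.\<close>
  also have "\<dots> \<le> eps (int k) * (\<bar>u\<bar> + (1 + (15 / 4) ^ CARD('d) * R))"
    using gu by (intro mult_left_mono) (auto simp: eps_def)
  finally have "\<bar>f_B (apsnd (keep_leading k) (f_B_inv (g $ i))) - u\<bar> \<le>
      (1 + eps (int k)) * (1 + (15 / 4) ^ CARD('d) * R) + eps (int k) * \<bar>u\<bar>"
    using gu unfolding distrib_left distrib_right by linarith
  then have "2 powi l * \<bar>f_B (apsnd (keep_leading k) (f_B_inv (g $ i))) - u\<bar> \<le>
      2 powi l * ((1 + eps (int k)) * (1 + (15 / 4) ^ CARD('d) * R) + eps (int k) * \<bar>u\<bar>)"
    by (intro mult_left_mono) auto
  moreover have "\<bar>zfp_block k q ts p w y $ i - y $ i\<bar> =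
      2 powi l * \<bar>f_B (apsnd (keep_leading k) (f_B_inv (g $ i))) - u\<bar>"
    unfolding out y by (simp add: abs_mult flip: right_diff_distrib)
  moreover have "eps (int k) * \<bar>y $ i\<bar> = 2 powi l * (eps (int k) * \<bar>u\<bar>)"
    unfolding y by (simp add: abs_mult)
  ultimately show ?thesis
    unfolding l_def[symmetric] R_def[symmetric] by (simp only: distrib_left[of "2 powi l"])
qed

section \<open>Blocks of zeros\<close>

lemma half_0: "half 0 = 0"
  by (simp add: half_def)

lemma L_lossy_d_0: "L_lossy_d ts 0 = 0"
proof -
  have "\<forall>i. L_lossy (\<chi> m. 0) $ i = 0"
    unfolding forall_4 by (simp add: L_lossy_def vector_4 half_0)
  then have "L_lossy_along t 0 = 0" for t :: 'a
    by (simp add: L_lossy_along_def vec_eq_iff)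
  then have "fold L_lossy_along ts 0 = 0"
    by (induction ts) auto
  then show ?thesis by (simp add: L_lossy_d_def)
qed

text \<open>As \<open>e_max 0\<close> is unspecified, the general error bound cannot be compared
  with \<open>e_max x\<close>. Instead, every stage keeps zero.\<close>

lemma zfp_block_0:
  assumes "bij p"
  shows "zfp_block k q ts p w 0 $ i = 0"
proof -
  have "supp (snd (f_B_inv 0)) = {}" by (simp add: supp_f_B_inv_eq_empty_iff)
  then have "f_B (to_integers q 0 $ j) = 0" for j :: "'a \<Rightarrow> 4"
    by (simp add: to_integers_component f_B_eq supp_trunc supp_shift)
  then have "(\<chi> j. \<lfloor>f_B (to_integers q 0 $ j)\<rfloor>) = (0 :: int ^ ('a \<Rightarrow> 4))"
    by (simp add: vec_eq_iff)
  moreover have "f_N (trunc S (f_N_inv 0)) = 0" for S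
    by (simp add: f_N_eq supp_trunc supp_f_N_inv_0)
  moreover have "(\<chi> j. 0) = (0 :: real ^ ('a \<Rightarrow> 4))" by (simp add: vec_eq_iff)
  ultimately show ?thesis
    using keep_leading_error[of k 0]
    by (simp add: zfp_block_component[OF assms] L_lossy_d_0)
qed

section \<open>Blocks of padded data\<close>

text \<open>In type \<open>4\<close> numbers are reduced modulo 4, which keeps 1, 2, 3 and 4
  distinct.\<close>

lemma of_nat_4_inj:
  fixes a b :: nat
  assumes "a < 4" "b < 4" "(of_nat (a + 1) :: 4) = of_nat (b + 1)"
  shows "a = b"
proof -
  have "a \<in> {0, 1, 2, 3}" "b \<in> {0, 1, 2, 3}" using assms(1,2) by auto
  then show ?thesis using assms(3) by auto
qed

text \<open>Quotient and remainder by 4 determine each coordinate; this is the uniqueness behind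
  \<open>THE\<close> in \<open>block\<close>.\<close>

lemma block_of_offset_of_inj:
  assumes "block_of u = block_of v" "offset_of u = offset_of v"
  shows "u = v"
proof
  fix t
  have "u t mod 4 = v t mod 4"
    by (rule of_nat_4_inj) (use assms(2) in \<open>simp_all add: offset_of_def fun_eq_iff\<close>)
  moreover have "u t div 4 = v t div 4"
    using assms(1) by (simp add: block_of_def fun_eq_iff)
  ultimately show "u t = v t" by (metis div_mult_mod_eq)
qed

lemma block_component: "block X (block_of u) $ offset_of u = X u"
proof -
  have "(THE v. block_of v = block_of u \<and> offset_of v = offset_of u) = u"
    by (rule the_equality) (auto intro: block_of_offset_of_inj)
  then show ?thesis by (simp add: block_def)
qed

lemma padded_block_cases:
  assumes "padded pos x X"
  shows "block X j $ m = 0 \<or> (\<exists>i. block X j $ m = x $ i)"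
proof -
  have "X u = 0 \<or> (\<exists>i. X u = x $ i)" for u
    using assms unfolding padded_def by (cases "u \<in> range pos") auto
  then show ?thesis by (simp add: block_def)
qed

text \<open>From \<open>d + 1 \<le> 2 ^ d\<close>: the summed rounding errors of the
  \<open>d\<close> directions stay below the constant \<open>k\<^sub>L\<close>.\<close>

lemma CARD_le_k_L: "7 / 4 * real CARD('d::finite) \<le> 7 / 4 * (2 ^ CARD('d) - 1)"
proof -
  have "CARD('d) + 1 \<le> 2 ^ CARD('d)" by (simp add: Suc_leI)
  then have "real (CARD('d) + 1) \<le> real (2 ^ CARD('d))" by (simp only: of_nat_le_iff)
  then show ?thesis by simp
qed

section \<open>From block errors to the guaranteed accuracy\<close>

theorem theorem5p3:
  fixes x xhat :: "real ^ 'n"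
    and k q b \<beta> :: nat
    and N :: "'d::finite \<Rightarrow> nat"
    and pos :: "'n \<Rightarrow> 'd \<Rightarrow> nat"
    and X :: "('d \<Rightarrow> nat) \<Rightarrow> real"
    and ts :: "'d list"
    and p :: "('d \<Rightarrow> 4) \<Rightarrow> ('d \<Rightarrow> 4)"
    and W :: "('d \<Rightarrow> nat) \<Rightarrow> int"
    and c k\<^sub>L D :: real
  assumes "x \<noteq> 0"
    and "\<forall>i. f_B_inv (x $ i) \<in> B_prec k"
    and "grid_layout N pos"
    and "padded pos x X"
    and "distinct ts" and "set ts = UNIV"
    and "bij p"
    and "fixed_accuracy \<beta> x X W"
    and "xhat = zfp k q ts p W pos X"
    and "k\<^sub>L = 7 / 4 * (2 ^ CARD('d) - 1)"
    and "c = eps (int q) * (k\<^sub>L * (1 + eps (int q)) + 1)"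
    and "D = ((4 / 15) ^ CARD('d) * 2 powi (- int b - e_max x) - eps (int k))
               / (1 + eps (int k)) - c"
    and "D > 0"
    and "real \<beta> \<ge> log 2 ((16 / 3 * (1 + c)) / D)"
  shows "infnorm (xhat - x) \<le> 2 powi (- int b)"
proof -
  define P where "P = (15 / 4 :: real) ^ CARD('d)"
  define E where "E = (2 :: real) powi e_max x"
  define \<epsilon>k where "\<epsilon>k = eps (int k)"
  define \<epsilon>q where "\<epsilon>q = eps (int q)"
  define \<epsilon>\<beta> where "\<epsilon>\<beta> = eps (int \<beta>)"
  have pos: "P > 0" "E > 0" "\<epsilon>k > 0" "\<epsilon>q > 0" "\<epsilon>\<beta> > 0"
    by (simp_all add: P_def E_def \<epsilon>k_def \<epsilon>q_def \<epsilon>\<beta>_def eps_def)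
  have "(15 / 4 :: real) ^ 1 \<le> P"
    unfolding P_def by (intro power_increasing) (simp_all add: Suc_leI)
  then have P: "P \<ge> 15 / 4" by simp
  have kL: "7 / 4 * real CARD('d) \<le> k\<^sub>L" "k\<^sub>L \<ge> 0"
    using CARD_le_k_L[where 'd = 'd] assms(10) by (auto intro: order_trans)
  \<comment> \<open>The summand 1 stands for the conversion to integers, \<open>7/4 * d\<close> for
    the lossy transform.\<close>
  have c: "\<epsilon>q * (7 / 4 * real CARD('d) + 1) \<le> c"
  proof -
    have "k\<^sub>L * 1 \<le> k\<^sub>L * (1 + \<epsilon>q)"
      using kL(2) pos(4) by (intro mult_left_mono) auto
    then show ?thesis
      unfolding assms(11) \<epsilon>q_def[symmetric] using kL(1) pos(4)
      by (intro mult_left_mono) auto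
  qed
  then have c0: "c \<ge> 0"
    using pos(4) by (smt (verit) mult_nonneg_nonneg of_nat_0_le_iff divide_nonneg_nonneg)
  \<comment> \<open>The bound on \<beta> reads \<open>16/3 * (1 + c) \<le> D * 2 ^ \<beta>\<close>.
    Now \<open>1 + c \<ge> 1\<close>, and \<open>\<epsilon>\<beta> * 2 ^ \<beta> = 2\<close> turns
    \<open>16/3\<close> into \<open>8/3\<close>.\<close>
  have D: "8 / 3 * \<epsilon>\<beta> \<le> D"
  proof -
    have "16 / 3 * (1 + c) / D \<le> 2 powr real \<beta>"
      using assms(13,14) c0 by (subst (asm) log_le_iff) (auto intro!: divide_pos_pos mult_pos_pos)
    then have "16 / 3 * (1 + c) \<le> D * 2 ^ \<beta>"
      using assms(13) by (simp add: powr_realpow field_simps)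
    moreover have "16 / 3 \<le> 16 / 3 * (1 + c)"
      using c0 by simp
    moreover have "8 / 3 * \<epsilon>\<beta> * 2 ^ \<beta> = 16 / 3"
      by (simp add: \<epsilon>\<beta>_def eps_def power_int_diff)
    ultimately have "8 / 3 * \<epsilon>\<beta> * 2 ^ \<beta> \<le> D * 2 ^ \<beta>"
      by (metis order_trans)
    then show ?thesis by simp
  qed
  \<comment> \<open>Unfolding \<open>D\<close> and multiplying by \<open>1 + \<epsilon>k\<close> and
    \<open>P * E\<close> turns the condition on \<beta> into the error budget
    \<open>total\<close>.\<close>
  have "c + 8 / 3 * \<epsilon>\<beta> \<le> ((4 / 15) ^ CARD('d) * 2 powi (- int b - e_max x) - \<epsilon>k) / (1 + \<epsilon>k)"
    using D unfolding assms(12) \<epsilon>k_def by linarith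
  then have "(1 + \<epsilon>k) * (c + 8 / 3 * \<epsilon>\<beta>) + \<epsilon>k \<le> (4 / 15) ^ CARD('d) * 2 powi (- int b - e_max x)"
    using pos(3) by (simp add: pos_le_divide_eq mult.commute)
  then have "P * E * ((1 + \<epsilon>k) * (c + 8 / 3 * \<epsilon>\<beta>) + \<epsilon>k) \<le>
      P * E * ((4 / 15) ^ CARD('d) * 2 powi (- int b - e_max x))"
    using pos by (intro mult_left_mono) auto
  also have "\<dots> = (P * (4 / 15) ^ CARD('d)) * (E * 2 powi (- int b - e_max x))"
    by (simp only: ac_simps)
  also have "P * (4 / 15) ^ CARD('d) = 1"
    unfolding P_def by (simp flip: power_mult_distrib)
  also have "E * 2 powi (- int b - e_max x) = 2 powi (- int b)"
    unfolding E_def by (simp flip: power_int_add)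
  finally have total: "P * E * ((1 + \<epsilon>k) * (c + 8 / 3 * \<epsilon>\<beta>) + \<epsilon>k) \<le> 2 powi (- int b)" by simp
  have "\<bar>(xhat - x) $ i\<bar> \<le> 2 powi (- int b)" for i
  proof -
    define j where "j = block_of (pos i)"
    define y where "y = block X j"
    define m where "m = offset_of (pos i)"
    have x: "x $ i = y $ m"
      using assms(4) block_component[of X "pos i"] by (simp add: padded_def y_def j_def m_def)
    have xhat: "xhat $ i = zfp_block k q ts p (W j) y $ m"
      by (simp add: assms(9) zfp_def Let_def j_def y_def m_def)
    show ?thesis
    proof (cases "y = 0")
      case True
      then show ?thesis using x xhat zfp_block_0[OF assms(7)] by simp
    next
      case False
      then have le: "e_max y \<le> e_max x"
        using padded_block_cases[OF assms(4)] by (intro e_max_mono) (auto simp: y_def)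
      then have E: "2 powi e_max y \<le> E"
        unfolding E_def by (intro power_int_increasing) auto
      have l: "2 powi block_exponent q y = 2 powi e_max y * \<epsilon>q"
        by (simp add: block_exponent_def \<epsilon>q_def eps_def algebra_simps flip: power_int_add)
      \<comment> \<open>With a fixed number of planes this follows from
        \<open>e_max y \<le> e_max x\<close>; with a common minimum plane both sides are
        equal.\<close>
      have planes: "2 powi e_max y * eps (W j) \<le> E * \<epsilon>\<beta>"
        using assms(8) unfolding fixed_accuracy_def
      proof
        assume "\<forall>j. W j = int \<beta>"
        then show ?thesis using E pos(5) by (simp add: \<epsilon>\<beta>_def)
      next
        assume "\<forall>j. W j = int \<beta> - (e_max x - e_max (block X j))"
        then have "e_max y + (1 - W j) = e_max x + (1 - int \<beta>)" by (simp add: y_def)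
        then have "(2::real) powi (e_max y + (1 - W j)) = 2 powi (e_max x + (1 - int \<beta>))"
          by (simp only:)
        then show ?thesis
          by (simp add: E_def \<epsilon>\<beta>_def eps_def flip: power_int_add)
      qed
      \<comment> \<open>After scaling back, the highest discarded plane has exponent
        \<open>e_max y + 2 - W j\<close>, one more than in
        \<open>2 powi e_max y * eps (W j)\<close>; thus \<open>4/3\<close> becomes
        \<open>8/3\<close>.\<close>
      have neg: "2 powi block_exponent q y * (4 / 3 * 2 powi (int q + 1 - W j)) =
          8 / 3 * (2 powi e_max y * eps (W j))"
      proof -
        have "(2::real) powi block_exponent q y * 2 powi (int q + 1 - W j) =
            2 * (2 powi e_max y * 2 powi (1 - W j))"
          by (simp add: block_exponent_def power_int_add power_int_diff)
        then show ?thesis by (simp add: eps_def)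
      qed
      have "\<bar>(xhat - x) $ i\<bar> \<le> 2 powi block_exponent q y * ((1 + \<epsilon>k) *
          (1 + P * (7 / 4 * CARD('d) + 4 / 3 * 2 powi (int q + 1 - W j)))) + \<epsilon>k * \<bar>y $ m\<bar>"
        unfolding vector_minus_component x xhat P_def \<epsilon>k_def
        by (rule zfp_block_error[OF assms(7,5,6)])
      also have "\<dots> = (1 + \<epsilon>k) * (2 powi e_max y * \<epsilon>q +
          P * (7 / 4 * CARD('d) * (2 powi e_max y * \<epsilon>q) + 8 / 3 * (2 powi e_max y * eps (W j)))) + \<epsilon>k * \<bar>y $ m\<bar>"
        unfolding neg[symmetric] l by (simp add: algebra_simps)
      also have "\<dots> \<le> (1 + \<epsilon>k) * (P * (E * \<epsilon>q) +
          P * (7 / 4 * CARD('d) * (E * \<epsilon>q) + 8 / 3 * (E * \<epsilon>\<beta>))) + \<epsilon>k * (P * E)"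
      proof (intro add_mono mult_left_mono planes)
        have 1: "2 powi e_max y * \<epsilon>q \<le> E * \<epsilon>q"
          using E pos(4) by (intro mult_right_mono) auto
        then show "2 powi e_max y * \<epsilon>q \<le> E * \<epsilon>q" .
        \<comment> \<open>The unamplified conversion error is enlarged by \<open>P\<close> so that
          \<open>P * E\<close> becomes a common factor.\<close>
        have "1 * (E * \<epsilon>q) \<le> P * (E * \<epsilon>q)"
          using P pos by (intro mult_right_mono) auto
        with 1 show "2 powi e_max y * \<epsilon>q \<le> P * (E * \<epsilon>q)" by linarith
        have "\<bar>y $ m\<bar> \<le> 2 powi (e_max y + 1)" by (rule abs_le_e_max)
        also have "\<dots> \<le> 2 * E" using E by (simp add: power_int_add)
        also have "\<dots> \<le> P * E" using P pos(2) by (intro mult_right_mono) auto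
        finally show "\<bar>y $ m\<bar> \<le> P * E" .
      qed (use pos in auto)
      also have "\<dots> = P * E * ((1 + \<epsilon>k) * (\<epsilon>q * (7 / 4 * CARD('d) + 1) + 8 / 3 * \<epsilon>\<beta>) + \<epsilon>k)"
        by (simp add: algebra_simps)
      also have "\<dots> \<le> P * E * ((1 + \<epsilon>k) * (c + 8 / 3 * \<epsilon>\<beta>) + \<epsilon>k)"
        using c pos by (intro mult_left_mono add_mono) auto
      also note total
      finally show ?thesis .
    qed
  qed
  then show ?thesis
    unfolding infnorm_cart by (intro cSup_least) auto
qed

end
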